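(* For every connected graph $G$ there exists an optimal ordering of $G$ which is conformal.
   Context: An ordering of $G=(V,E)$ is a bijection $\alpha:V\to\{1,\dots,|V|\}$; with $N[v]=\{v\}\cup\{u:uv\in E\}$, $\mathrm{prf}_\alpha(G)=\sum_{v\in V}(\alpha(v)-\min\{\alpha(u):u\in N[v]\})$, and $\alpha$ is optimal if it minimizes $\mathrm{prf}_\alpha(G)$ over all orderings. For $x\in V$, $N_1(x)$ is the set of neighbors of $x$ of degree $1$. An ordering $\alpha$ is conformal for $x$ if $\{\alpha(w): w\in N_1(x)\}$ is a (possibly empty) set of consecutive integers and $\alpha(w)<\alpha(x)$ for all $w\in N_1(x)$; $\alpha$ is conformal (for $G$) if it is conformal for every vertex of $G$.
   Formalization: The connected graph on exactly two vertices is excluded: there each vertex is a degree-1 neighbor of the other, so conformality would require each to precede the other and no conformal ordering exists. *)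

theory Defs
  imports "Graph_Theory.Digraph_Component" "Graph_Theory.Pair_Digraph"
begin

text \<open>
  Finite simple graphs are modelled by the locale \<^locale>\<open>pair_graph\<close>: a finite vertex set
  with a symmetric and irreflexive arc relation, each edge being represented by its two arcs.
\<close>

definition closed_nbhd :: "'a pair_pre_digraph \<Rightarrow> 'a \<Rightarrow> 'a set" where
  "closed_nbhd G v = insert v {u. (u, v) \<in> parcs G}"

text \<open>
  Since every edge contributes exactly one outgoing arc at each of its two ends, the out-degree
  is the usual degree of a vertex.
\<close>

definition leaf_nbrs :: "'a pair_pre_digraph \<Rightarrow> 'a \<Rightarrow> 'a set" where
  "leaf_nbrs G x = {w. (w, x) \<in> parcs G \<and> out_degree (with_proj G) w = 1}"

definition graph_ordering :: "'a pair_pre_digraph \<Rightarrow> ('a \<Rightarrow> nat) \<Rightarrow> bool" where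
  "graph_ordering G \<alpha> \<longleftrightarrow> bij_betw \<alpha> (pverts G) {1..card (pverts G)}"

text \<open>
  The subtraction on the natural numbers does not truncate, because \<open>v\<close> itself belongs to its
  closed neighbourhood.
\<close>

definition graph_profile :: "'a pair_pre_digraph \<Rightarrow> ('a \<Rightarrow> nat) \<Rightarrow> nat" where
  "graph_profile G \<alpha> = (\<Sum>v\<in>pverts G. \<alpha> v - Min (\<alpha> ` closed_nbhd G v))"

definition optimal_ordering :: "'a pair_pre_digraph \<Rightarrow> ('a \<Rightarrow> nat) \<Rightarrow> bool" where
  "optimal_ordering G \<alpha> \<longleftrightarrow> graph_ordering G \<alpha> \<and>
     (\<forall>\<beta>. graph_ordering G \<beta> \<longrightarrow> graph_profile G \<alpha> \<le> graph_profile G \<beta>)"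

text \<open>The case \<open>b < a\<close> covers vertices without neighbours of degree one.\<close>

definition conformal_for :: "'a pair_pre_digraph \<Rightarrow> ('a \<Rightarrow> nat) \<Rightarrow> 'a \<Rightarrow> bool" where
  "conformal_for G \<alpha> x \<longleftrightarrow>
     (\<exists>a b. \<alpha> ` leaf_nbrs G x = {a..b}) \<and> (\<forall>w\<in>leaf_nbrs G x. \<alpha> w < \<alpha> x)"

text \<open>
  The complete graph on two vertices has no conformal ordering: each of its vertices is a
  neighbour of degree one of the other, so each would have to precede the other.
\<close>

definition conformal :: "'a pair_pre_digraph \<Rightarrow> ('a \<Rightarrow> nat) \<Rightarrow> bool" where
  "conformal G \<alpha> \<longleftrightarrow> (\<forall>x\<in>pverts G. conformal_for G \<alpha> x)"

end

theory Submission
  imports Defs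
begin

text \<open>
  List the vertices in the order given by \<open>\<alpha>\<close>, and for a vertex set \<open>A\<close> let \<open>f A\<close> be the number
  of vertices outside \<open>A\<close> with a neighbour in \<open>A\<close>. The profile of \<open>\<alpha>\<close> is the sum of \<open>f\<close> over the
  prefixes of the list. Moving a leaf that comes after its neighbour \<open>x\<close> to the place directly
  before \<open>x\<close> does not increase this sum, so some optimal list has every leaf before its
  neighbour. Among those, take one with the largest number of adjacent pairs of leaves hanging
  at the same vertex. If the leaves at \<open>x\<close> were not consecutive, the list would be
  \<open>S @ R @ T @ R' @ U\<close> with \<open>R\<close>, \<open>R'\<close> maximal runs of leaves at \<open>x\<close>. A leaf at \<open>x\<close> that follows
  another one leaves \<open>f\<close> unchanged. Hence \<open>f (S \<union> R \<union> T) < f (S \<union> R)\<close> would make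
  \<open>S @ T @ R @ R' @ U\<close> strictly cheaper; so \<open>f (S \<union> R) \<le> f (S \<union> R \<union> T)\<close>, and
  \<open>S @ R @ R' @ T @ U\<close> is optimal as well but has more adjacent pairs.
\<close>

section \<open>Boundaries, costs and counting functions for lists\<close>

definition ext_boundary :: "'a pair_pre_digraph \<Rightarrow> 'a set \<Rightarrow> 'a set" where
  "ext_boundary G S = {v. v \<notin> S \<and> (\<exists>u\<in>S. (u, v) \<in> parcs G)}"

text \<open>The set \<open>A\<close> holds the vertices placed before the list, so that a segment
  can be priced separately from what precedes it.\<close>

primrec boundary_cost :: "'a pair_pre_digraph \<Rightarrow> 'a set \<Rightarrow> 'a list \<Rightarrow> nat" where
  "boundary_cost G A [] = 0"
| "boundary_cost G A (x # xs) = card (ext_boundary G (insert x A)) + boundary_cost G (insert x A) xs"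

definition vertex_list :: "'a pair_pre_digraph \<Rightarrow> 'a list \<Rightarrow> bool" where
  "vertex_list G xs \<longleftrightarrow> distinct xs \<and> set xs = pverts G"

definition optimal_list :: "'a pair_pre_digraph \<Rightarrow> 'a list \<Rightarrow> bool" where
  "optimal_list G xs \<longleftrightarrow> vertex_list G xs \<and>
     (\<forall>ys. vertex_list G ys \<longrightarrow> boundary_cost G {} xs \<le> boundary_cost G {} ys)"

text \<open>Number of pairs in the wrong order; it serves as the measure that is minimised among the
  optimal lists.\<close>

primrec late_leaves :: "'a pair_pre_digraph \<Rightarrow> 'a list \<Rightarrow> nat" where
  "late_leaves G [] = 0"
| "late_leaves G (x # xs) = length (filter (\<lambda>w. w \<in> leaf_nbrs G x) xs) + late_leaves G xs"

fun adjacencies :: "('a \<Rightarrow> 'a \<Rightarrow> bool) \<Rightarrow> 'a list \<Rightarrow> nat" where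
  "adjacencies R (x # y # zs) = of_bool (R x y) + adjacencies R (y # zs)"
| "adjacencies R xs = 0"

definition siblings :: "'a pair_pre_digraph \<Rightarrow> 'a \<Rightarrow> 'a \<Rightarrow> bool" where
  "siblings G u v \<longleftrightarrow> (\<exists>x. u \<in> leaf_nbrs G x \<and> v \<in> leaf_nbrs G x)"

section \<open>Elementary facts about costs and counts\<close>

lemma boundary_cost_append:
  "boundary_cost G A (xs @ ys) = boundary_cost G A xs + boundary_cost G (A \<union> set xs) ys"
  by (induction xs arbitrary: A) auto

lemma boundary_cost_conv_sum:
  "boundary_cost G A xs = (\<Sum>i<length xs. card (ext_boundary G (A \<union> set (take (Suc i) xs))))"
proof (induction xs arbitrary: A)
  case (Cons x xs)
  then show ?case
    by (simp only: length_Cons sum.lessThan_Suc_shift boundary_cost.simps take_Suc_Cons) simp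
qed simp

text \<open>The costs are compared prefix by prefix; \<open>Y\<close> is nonempty because every
  prefix that is charged contains the head of \<open>xs\<close>. Applied with \<open>k = 1\<close>
  and with \<open>k = 0\<close>.\<close>

lemma boundary_cost_add:
  assumes "\<And>Y. Y \<subseteq> set xs \<Longrightarrow> Y \<noteq> {} \<Longrightarrow>
      card (ext_boundary G (A \<union> Y)) = card (ext_boundary G (B \<union> Y)) + k"
  shows "boundary_cost G A xs = boundary_cost G B xs + length xs * k"
proof -
  have "card (ext_boundary G (A \<union> set (take (Suc i) xs)))
      = card (ext_boundary G (B \<union> set (take (Suc i) xs))) + k" if "i < length xs" for i
    by (rule assms) (use that in \<open>auto simp: set_take_subset\<close>)
  then show ?thesis
    by (simp add: boundary_cost_conv_sum sum.distrib)
qed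

lemma boundary_cost_mono:
  assumes "\<And>Y. Y \<subseteq> set xs \<Longrightarrow>
      card (ext_boundary G (A \<union> Y)) \<le> card (ext_boundary G (B \<union> Y))"
  shows "boundary_cost G A xs \<le> boundary_cost G B xs"
  unfolding boundary_cost_conv_sum by (intro sum_mono assms set_take_subset)

lemma late_leaves_append:
  "late_leaves G (xs @ ys) = late_leaves G xs + late_leaves G ys +
     (\<Sum>x\<leftarrow>xs. length (filter (\<lambda>w. w \<in> leaf_nbrs G x) ys))"
  by (induction xs) auto

lemma adjacencies_append:
  "adjacencies R (xs @ ys) = adjacencies R xs + adjacencies R ys +
     of_bool (xs \<noteq> [] \<and> ys \<noteq> [] \<and> R (last xs) (hd ys))"
proof (induction R xs rule: adjacencies.induct)
  case ("2_2" R v)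
  then show ?case by (cases ys) auto
qed auto

lemma adjacencies_le: "adjacencies R xs \<le> length xs"
  by (induction R xs rule: adjacencies.induct) auto

context pair_graph
begin

section \<open>Leaves and their effect on boundaries\<close>

lemma leaf_nbrs_arc: "w \<in> leaf_nbrs G x \<Longrightarrow> (w, x) \<in> parcs G \<and> (x, w) \<in> parcs G \<and> w \<noteq> x"
  using arcs_symmetric no_loops' by (auto simp: leaf_nbrs_def)

text \<open>Degree one leaves a single outgoing arc, and symmetry carries this over to incoming
  arcs.\<close>

lemma leaf_nbrs_arc_unique:
  assumes "w \<in> leaf_nbrs G x"
  shows "(w, y) \<in> parcs G \<longleftrightarrow> y = x" and "(y, w) \<in> parcs G \<longleftrightarrow> y = x"
proof -
  from assms have wx: "(w, x) \<in> parcs G" and "card (out_arcs (with_proj G) w) = 1"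
    by (auto simp: leaf_nbrs_def out_degree_def)
  then obtain e where e: "out_arcs (with_proj G) w = {e}"
    by (auto simp: card_1_singleton_iff)
  show 1: "(w, y) \<in> parcs G \<longleftrightarrow> y = x" for y
  proof
    assume "(w, y) \<in> parcs G"
    then have "(w, y) \<in> out_arcs (with_proj G) w" "(w, x) \<in> out_arcs (with_proj G) w"
      using wx by (auto simp: out_arcs_def)
    then show "y = x" using e by auto
  qed (use wx in simp)
  show "(y, w) \<in> parcs G \<longleftrightarrow> y = x"
    using 1[of y] arcs_symmetric by blast
qed

lemma leaf_nbrs_unique: "w \<in> leaf_nbrs G x \<Longrightarrow> w \<in> leaf_nbrs G y \<Longrightarrow> x = y"
  using leaf_nbrs_arc_unique(1) leaf_nbrs_arc by blast

lemma leaf_nbrs_subset: "leaf_nbrs G x \<subseteq> pverts G"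
  using leaf_nbrs_arc in_arcsD1 by blast

lemma ext_boundary_subset: "ext_boundary G S \<subseteq> pverts G"
  by (auto simp: ext_boundary_def dest: in_arcsD2)

lemma finite_ext_boundary [simp]: "finite (ext_boundary G S)"
  using ext_boundary_subset pair_finite_verts finite_subset by blast

text \<open>The leaves in \<open>R\<close> see only \<open>x\<close>: they add nothing but
  \<open>x\<close> to the boundary, and they were not in it before since \<open>x\<close> is not in
  \<open>S\<close>. The result does not depend on which leaves, or how many, form
  \<open>R\<close>.\<close>

lemma ext_boundary_Un_leaves:
  assumes "R \<subseteq> leaf_nbrs G x" "R \<noteq> {}" "x \<notin> S" "x \<notin> R"
  shows "ext_boundary G (S \<union> R) = insert x (ext_boundary G S)"
proof -
  have "(u, v) \<in> parcs G \<longleftrightarrow> v = x" "(v, u) \<in> parcs G \<longleftrightarrow> v = x" if "u \<in> R" for u v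
    using leaf_nbrs_arc_unique assms(1) that by blast+
  then show ?thesis
    using assms(2-4) unfolding ext_boundary_def by auto
qed

text \<open>Once \<open>x\<close> is placed, a leaf at \<open>x\<close> is charged to every prefix
  until it is placed itself, and placing it exposes no new vertex.\<close>

lemma ext_boundary_insert_leaf:
  assumes "w \<in> leaf_nbrs G x" "x \<in> S" "w \<notin> S"
  shows "ext_boundary G S = insert w (ext_boundary G (insert w S))"
    and "w \<notin> ext_boundary G (insert w S)"
  using assms leaf_nbrs_arc_unique[OF assms(1)] leaf_nbrs_arc[OF assms(1)]
  by (auto simp: ext_boundary_def)

text \<open>The first leaf puts \<open>x\<close> into the boundary and the later ones change
  nothing, so all leaves of the run are charged the same amount.\<close>

lemma boundary_cost_leaves:
  assumes "set ws \<subseteq> leaf_nbrs G x" "x \<notin> S"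
  shows "boundary_cost G S ws = length ws * card (insert x (ext_boundary G S))"
proof -
  have x: "x \<notin> leaf_nbrs G x"
    using leaf_nbrs_arc by blast
  have "card (ext_boundary G (S \<union> set (take (Suc i) ws))) = card (insert x (ext_boundary G S))"
    if "i < length ws" for i
  proof -
    have "set (take (Suc i) ws) \<subseteq> leaf_nbrs G x"
      using assms(1) set_take_subset by fast
    moreover have "set (take (Suc i) ws) \<noteq> {}"
      using that by auto
    ultimately show ?thesis
      using ext_boundary_Un_leaves assms(2) x by (metis subsetD)
  qed
  then show ?thesis
    by (simp add: boundary_cost_conv_sum)
qed

text \<open>
  Double counting: \<open>v\<close> lies in the boundary of exactly those prefixes that contain one of its
  neighbours but not \<open>v\<close> itself.
\<close>
lemma graph_profile_eq_boundary_cost: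
  assumes xs: "vertex_list G xs" and \<alpha>: "\<And>i. i < length xs \<Longrightarrow> \<alpha> (xs ! i) = Suc i"
  shows "graph_profile G \<alpha> = boundary_cost G {} xs"
proof -
  let ?P = "\<lambda>i. set (take (Suc i) xs)"
  have V: "pverts G = (!) xs ` {..<length xs}"
    using xs by (auto simp: vertex_list_def set_conv_nth)
  have P: "u \<in> ?P i \<longleftrightarrow> \<alpha> u \<le> Suc i" if "u \<in> pverts G" "i < length xs" for u i
  proof -
    from that V obtain j where j: "u = xs ! j" "j < length xs" by auto
    have "?P i = (!) xs ` {..i}"
      using nth_image[of "Suc i" xs] \<open>i < length xs\<close>
      by (simp add: atLeast0LessThan lessThan_Suc_atMost)
    then have "u \<in> ?P i \<longleftrightarrow> j \<le> i"
      using j \<open>i < length xs\<close> xs by (auto simp: vertex_list_def nth_eq_iff_index_eq)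
    then show ?thesis using \<alpha> j by simp
  qed
  have "card {i. i < length xs \<and> v \<in> ext_boundary G (?P i)} = \<alpha> v - Min (\<alpha> ` closed_nbhd G v)"
    if v: "v \<in> pverts G" for v
  proof -
    let ?m = "Min (\<alpha> ` closed_nbhd G v)"
    have sub: "closed_nbhd G v \<subseteq> pverts G"
      using v in_arcsD1 by (auto simp: closed_nbhd_def)
    then have fin: "finite (\<alpha> ` closed_nbhd G v)"
      using pair_finite_verts finite_subset by blast
    have ne: "\<alpha> ` closed_nbhd G v \<noteq> {}"
      by (auto simp: closed_nbhd_def)
    have \<alpha>V: "1 \<le> \<alpha> u \<and> \<alpha> u \<le> length xs" if "u \<in> pverts G" for u
      using that V \<alpha> by auto
    have "?m \<in> \<alpha> ` closed_nbhd G v"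
      using Min_in[OF fin ne] .
    then have m1: "1 \<le> ?m"
      using sub \<alpha>V by auto
    have "v \<in> ext_boundary G (?P i) \<longleftrightarrow> ?m \<le> Suc i \<and> Suc i < \<alpha> v" if "i < length xs" for i
    proof -
      have Pi: "u \<in> ?P i \<longleftrightarrow> u \<in> pverts G \<and> \<alpha> u \<le> Suc i" for u
        using P[OF _ that] xs set_take_subset[of "Suc i" xs] by (auto simp: vertex_list_def)
      have "v \<in> ext_boundary G (?P i) \<longleftrightarrow>
          Suc i < \<alpha> v \<and> (\<exists>u. (u, v) \<in> parcs G \<and> \<alpha> u \<le> Suc i)"
        using v in_arcsD1 by (auto simp: ext_boundary_def Pi Bex_def)
      \<comment> \<open>Adding \<open>v\<close> itself to the candidates is harmless, as
        \<open>Suc i < \<alpha> v\<close> rules it out.\<close>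
      also have "\<dots> \<longleftrightarrow> Suc i < \<alpha> v \<and> (\<exists>u\<in>closed_nbhd G v. \<alpha> u \<le> Suc i)"
        by (auto simp: closed_nbhd_def)
      also have "\<dots> \<longleftrightarrow> ?m \<le> Suc i \<and> Suc i < \<alpha> v"
        using Min_le_iff[OF fin ne, of "Suc i"] by auto
      finally show ?thesis .
    qed
    then have "{i. i < length xs \<and> v \<in> ext_boundary G (?P i)} = {i. ?m \<le> Suc i \<and> Suc i < \<alpha> v}"
      using \<alpha>V[OF v] by auto
    \<comment> \<open>The index \<open>i\<close> stands for the prefix of length
      \<open>Suc i\<close>, so both ends shift down by one; \<open>1 \<le> ?m\<close> keeps the
      subtraction exact.\<close>
    also have "\<dots> = {?m - 1..<\<alpha> v - 1}"
      using m1 by auto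
    finally show ?thesis
      using m1 by simp
  qed
  then have "graph_profile G \<alpha>
      = (\<Sum>v\<in>pverts G. \<Sum>i<length xs. of_bool (v \<in> ext_boundary G (?P i)))"
    unfolding graph_profile_def
    by (intro sum.cong refl) (simp add: Int_def)
  also have "\<dots> = (\<Sum>i<length xs. \<Sum>v\<in>pverts G. of_bool (v \<in> ext_boundary G (?P i)))"
    by (rule sum.swap)
  also have "\<dots> = (\<Sum>i<length xs. card (ext_boundary G (?P i)))"
  proof (intro sum.cong refl)
    fix i
    have "pverts G \<inter> ext_boundary G (?P i) = ext_boundary G (?P i)"
      using ext_boundary_subset by blast
    then show "(\<Sum>v\<in>pverts G. of_bool (v \<in> ext_boundary G (?P i))) = card (ext_boundary G (?P i))"
      using pair_finite_verts by simp
  qed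
  finally show ?thesis
    by (simp add: boundary_cost_conv_sum)
qed

section \<open>Translation between orderings and vertex lists\<close>

lemma graph_ordering_imp_vertex_list:
  assumes "graph_ordering G \<alpha>"
  obtains xs where "vertex_list G xs" "\<And>i. i < length xs \<Longrightarrow> \<alpha> (xs ! i) = Suc i"
proof
  let ?n = "card (pverts G)"
  let ?\<beta> = "inv_into (pverts G) \<alpha>"
  let ?xs = "map ?\<beta> [1..<Suc ?n]"
  have \<alpha>: "bij_betw \<alpha> (pverts G) {1..?n}"
    using assms by (simp add: graph_ordering_def)
  have "bij_betw ?\<beta> {1..?n} (pverts G)"
    using bij_betw_inv_into[OF \<alpha>] .
  then have "bij_betw ?\<beta> (set [1..<Suc ?n]) (pverts G)"
    by (simp add: atLeastLessThanSuc_atLeastAtMost del: upt_Suc)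
  then show "vertex_list G ?xs"
    by (simp add: vertex_list_def distinct_map bij_betw_def del: upt_Suc set_upt)
  show "\<alpha> (?xs ! i) = Suc i" if "i < length ?xs" for i
    using that bij_betw_inv_into_right[OF \<alpha>, of "Suc i"] by (simp del: upt_Suc)
qed

lemma vertex_list_imp_graph_ordering:
  assumes "vertex_list G xs"
  obtains \<alpha> where "graph_ordering G \<alpha>" "\<And>i. i < length xs \<Longrightarrow> \<alpha> (xs ! i) = Suc i"
proof
  let ?\<alpha> = "\<lambda>v. the (map_of (zip xs [1..<Suc (length xs)]) v)"
  have d: "distinct xs" and V: "set xs = pverts G"
    using assms by (auto simp: vertex_list_def)
  show \<alpha>: "?\<alpha> (xs ! i) = Suc i" if "i < length xs" for i
    using that d by (subst map_of_zip_nth) (simp_all del: upt_Suc)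
  have "map ?\<alpha> xs = [1..<Suc (length xs)]"
    using \<alpha> by (intro nth_equalityI) (simp_all del: upt_Suc)
  then have "distinct (map ?\<alpha> xs)" "set (map ?\<alpha> xs) = {1..length xs}"
    by (simp_all only: distinct_upt set_upt atLeastLessThanSuc_atLeastAtMost)
  then show "graph_ordering G ?\<alpha>"
    using d V distinct_card[OF d] by (simp add: graph_ordering_def bij_betw_def distinct_map)
qed

lemma optimal_list_imp_optimal_ordering:
  assumes "optimal_list G xs" and \<alpha>: "graph_ordering G \<alpha>" "\<And>i. i < length xs \<Longrightarrow> \<alpha> (xs ! i) = Suc i"
  shows "optimal_ordering G \<alpha>"
  unfolding optimal_ordering_def
proof (intro conjI allI impI)
  fix \<beta> assume "graph_ordering G \<beta>"
  then obtain ys where ys: "vertex_list G ys" "\<And>i. i < length ys \<Longrightarrow> \<beta> (ys ! i) = Suc i"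
    using graph_ordering_imp_vertex_list by metis
  have xs: "vertex_list G xs"
    using assms(1) by (simp add: optimal_list_def)
  have "graph_profile G \<alpha> = boundary_cost G {} xs" "graph_profile G \<beta> = boundary_cost G {} ys"
    by (rule graph_profile_eq_boundary_cost; fact)+
  then show "graph_profile G \<alpha> \<le> graph_profile G \<beta>"
    using assms(1) ys(1) by (simp add: optimal_list_def)
qed (fact \<alpha>)

lemma optimal_list_exists: "\<exists>xs. optimal_list G xs"
proof -
  have "\<exists>xs. vertex_list G xs"
    using finite_distinct_list[OF pair_finite_verts] by (auto simp: vertex_list_def)
  then show ?thesis
    using ex_has_least_nat[of "vertex_list G" _ "boundary_cost G {}"]
    by (auto simp: optimal_list_def)
qed

lemma optimal_list_trans:
  assumes "optimal_list G xs" "vertex_list G ys" "boundary_cost G {} ys \<le> boundary_cost G {} xs"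
  shows "optimal_list G ys"
  using assms order_trans unfolding optimal_list_def by blast

section \<open>The two exchange moves\<close>

text \<open>The prefixes ending at \<open>x\<close> or inside \<open>T\<close> each lose
  \<open>w\<close> from their boundary, a saving of \<open>Suc (length T)\<close>. This pays for
  replacing the old prefix ending at \<open>w\<close> by the new, shorter one ending at
  \<open>w\<close>.\<close>

lemma boundary_cost_leaf_before_parent:
  assumes dist: "distinct (S @ x # T @ w # U)" and w: "w \<in> leaf_nbrs G x"
  shows "boundary_cost G {} (S @ w # x # T @ U) \<le> boundary_cost G {} (S @ x # T @ w # U)"
proof -
  let ?f = "\<lambda>A. card (ext_boundary G A)"
  let ?A = "set S" and ?B = "insert x (set S \<union> set T)"
  have "boundary_cost G (insert x ?A) T = boundary_cost G (insert x (insert w ?A)) T + length T * 1"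
  proof (rule boundary_cost_add)
    fix Y assume "Y \<subseteq> set T"
    then have "w \<notin> insert x ?A \<union> Y"
      using dist by auto
    from ext_boundary_insert_leaf[OF w _ this]
    show "?f (insert x ?A \<union> Y) = ?f (insert x (insert w ?A) \<union> Y) + 1"
      by (simp add: insert_commute)
  qed
  moreover have "?f (insert x ?A) = ?f (insert x (insert w ?A)) + 1"
    using ext_boundary_insert_leaf[OF w, of "insert x ?A"] leaf_nbrs_arc[OF w] dist
    by (simp add: insert_commute)
  moreover have "?f (insert w ?A) \<le> Suc (length T) + ?f (insert w ?B)"
  proof -
    \<comment> \<open>A boundary vertex of the shorter prefix can leave the boundary only by being
      placed, hence it is \<open>x\<close> or lies in \<open>T\<close>.\<close>
    have "ext_boundary G (insert w ?A) \<subseteq> insert x (set T) \<union> ext_boundary G (insert w ?B)"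
      by (auto simp: ext_boundary_def)
    then have "?f (insert w ?A) \<le> card (insert x (set T) \<union> ext_boundary G (insert w ?B))"
      by (intro card_mono) auto
    also have "\<dots> \<le> card (insert x (set T)) + ?f (insert w ?B)"
      by (rule card_Un_le)
    also have "card (insert x (set T)) \<le> Suc (length T)"
      by (rule order_trans[OF card_insert_le_m1]) (auto simp: card_length)
    finally show ?thesis by simp
  qed
  ultimately show ?thesis
    by (simp add: boundary_cost_append insert_commute Un_commute)
qed

lemma boundary_cost_join_leaf_runs:
  assumes opt: "optimal_list G (S @ R @ T @ R' @ U)"
    and R: "set R \<subseteq> leaf_nbrs G x" "R \<noteq> []" and R': "set R' \<subseteq> leaf_nbrs G x"
    and x: "x \<notin> set (S @ R @ T @ R')"
  shows "optimal_list G (S @ R @ R' @ T @ U)"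
proof -
  let ?f = "\<lambda>A. card (ext_boundary G A)"
  let ?A = "set S \<union> set R"
  have lists: "vertex_list G (S @ T @ R @ R' @ U)" "vertex_list G (S @ R @ R' @ T @ U)"
    using opt by (auto simp: optimal_list_def vertex_list_def)
  \<comment> \<open>As \<open>x\<close> is still unplaced, the presence of \<open>R\<close> amounts
    to adding \<open>x\<close> to the boundary.\<close>
  have bd: "ext_boundary G (set S \<union> Y \<union> set R) = insert x (ext_boundary G (set S \<union> Y))"
    if "Y \<subseteq> set T" for Y
    using R x that by (intro ext_boundary_Un_leaves) auto
  have "?f ?A \<le> ?f (?A \<union> set T)"
  proof (rule ccontr)
    assume less: "\<not> ?thesis"
    have "boundary_cost G {} (S @ R @ T @ R' @ U) \<le> boundary_cost G {} (S @ T @ R @ R' @ U)"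
      using opt lists(1) by (simp add: optimal_list_def)
    \<comment> \<open>Moving \<open>T\<close> ahead of \<open>R\<close> does not make
      \<open>T\<close> dearer: by \<open>bd\<close>, its prefixes can only lose
      \<open>x\<close>.\<close>
    moreover have "boundary_cost G (set S) T \<le> boundary_cost G ?A T"
    proof (rule boundary_cost_mono)
      fix Y assume "Y \<subseteq> set T"
      from bd[OF this] show "?f (set S \<union> Y) \<le> ?f (?A \<union> Y)"
        by (simp add: Un_ac card_insert_le)
    qed
    moreover have "boundary_cost G (set S) R = length R * ?f ?A"
      using R x boundary_cost_leaves[of R x "set S"] bd[of "{}"] by simp
    moreover have "boundary_cost G (set S \<union> set T) R = length R * ?f (?A \<union> set T)"
      using R x boundary_cost_leaves[of R x "set S \<union> set T"] bd[of "set T"] by (simp add: Un_ac)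
    moreover have "length R * ?f (?A \<union> set T) < length R * ?f ?A"
      using less R by simp
    ultimately show False
      by (simp only: boundary_cost_append Un_ac Un_empty_left)
  qed
  moreover have "boundary_cost G ?A R' = length R' * ?f ?A"
    using R' x boundary_cost_leaves[of R' x ?A] bd[of "{}"] by simp
  moreover have "boundary_cost G (?A \<union> set T) R' = length R' * ?f (?A \<union> set T)"
    using R' x boundary_cost_leaves[of R' x "?A \<union> set T"] bd[of "set T"] by (simp add: Un_ac)
  \<comment> \<open>\<open>R\<close> already has \<open>x\<close> in the boundary, so placing
    \<open>R'\<close> before \<open>T\<close> leaves the price of \<open>T\<close>
    unchanged.\<close>
  moreover have "boundary_cost G (?A \<union> set R') T = boundary_cost G ?A T + length T * 0"
  proof (rule boundary_cost_add)
    fix Y assume Y: "Y \<subseteq> set T"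
    have "ext_boundary G (set S \<union> Y \<union> (set R \<union> set R')) = insert x (ext_boundary G (set S \<union> Y))"
      using R R' x Y by (intro ext_boundary_Un_leaves) auto
    with bd[OF Y] show "?f (?A \<union> set R' \<union> Y) = ?f (?A \<union> Y) + 0"
      by (simp add: Un_ac)
  qed
  ultimately show ?thesis
    by (intro optimal_list_trans[OF opt lists(2)])
      (simp add: boundary_cost_append Un_ac)
qed

section \<open>Extremal choice of an optimal list\<close>

text \<open>A leaf at \<open>w\<close> could only be \<open>x\<close>, and then \<open>w\<close> and
  \<open>x\<close> would form a whole component. Connectedness and the exclusion of two vertices
  enter the proof here.\<close>

lemma leaf_nbrs_of_leaf:
  assumes "Digraph_Component.connected (with_proj G)" "card (pverts G) \<noteq> 2" "w \<in> leaf_nbrs G x"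
  shows "leaf_nbrs G w = {}"
proof (rule ccontr)
  assume "leaf_nbrs G w \<noteq> {}"
  then obtain u where u: "u \<in> leaf_nbrs G w"
    by blast
  then have "u = x"
    using leaf_nbrs_arc_unique(2)[OF assms(3)] leaf_nbrs_arc by blast
  with u have x: "x \<in> leaf_nbrs G w"
    by simp
  have "strongly_connected (with_proj G)"
    using symmetric_connected_imp_strongly_connected sym_arcs assms(1) by blast
  then have reach: "w \<rightarrow>\<^sup>*\<^bsub>with_proj G\<^esub> v" if "v \<in> pverts G" for v
    using that assms(3) leaf_nbrs_subset by (auto simp: strongly_connected_def)
  have "v \<in> {w, x}" if "w \<rightarrow>\<^sup>*\<^bsub>with_proj G\<^esub> v" for v
    using that
    by (induction rule: reachable_induct)
      (use leaf_nbrs_arc_unique[OF assms(3)] leaf_nbrs_arc_unique[OF x] in auto)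
  with reach have "pverts G = {w, x}"
    using assms(3) x leaf_nbrs_subset by blast
  then show False
    using assms(2) leaf_nbrs_arc[OF assms(3)] by simp
qed

lemma optimal_list_leaves_first:
  assumes "\<And>w x. w \<in> leaf_nbrs G x \<Longrightarrow> leaf_nbrs G w = {}"
  shows "\<exists>xs. optimal_list G xs \<and> sorted_wrt (\<lambda>u v. v \<notin> leaf_nbrs G u) xs"
proof -
  obtain xs where opt: "optimal_list G xs"
    and min: "\<And>ys. optimal_list G ys \<Longrightarrow> late_leaves G xs \<le> late_leaves G ys"
    using optimal_list_exists ex_has_least_nat[of "optimal_list G" _ "late_leaves G"] by blast
  have "sorted_wrt (\<lambda>u v. v \<notin> leaf_nbrs G u) xs"
  proof (rule ccontr)
    assume "\<not> ?thesis"
    then have "\<exists>S x V w. xs = S @ x # V \<and> w \<in> set V \<and> w \<in> leaf_nbrs G x"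
    proof (induction xs)
      case (Cons a xs)
      then consider w where "w \<in> set xs" "w \<in> leaf_nbrs G a"
        | "\<not> sorted_wrt (\<lambda>u v. v \<notin> leaf_nbrs G u) xs"
        by auto
      then show ?case
      proof cases
        case 1
        then show ?thesis by blast
      next
        case 2
        then show ?thesis
          using Cons.IH by (metis append_Cons)
      qed
    qed simp
    then obtain S x T w U where xs: "xs = S @ x # T @ w # U" and w: "w \<in> leaf_nbrs G x"
      by (metis split_list)
    have "optimal_list G (S @ w # x # T @ U)"
      using opt w unfolding xs
      by (intro optimal_list_trans[OF _ _ boundary_cost_leaf_before_parent])
        (auto simp: optimal_list_def vertex_list_def)
    \<comment> \<open>Writing the counts with \<open>of_bool\<close> makes the two values of
      \<open>late_leaves\<close> comparable by linear arithmetic. The pair of \<open>x\<close> and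
      \<open>w\<close> disappears, and \<open>w\<close> creates no new one because no leaf hangs at
      it.\<close>
    moreover have "length (filter P (a # as)) = of_bool (P a) + length (filter P as)"
      for P and a :: 'a and as
      by simp
    ultimately show False
      using min[of "S @ w # x # T @ U"] w assms[OF w]
      by (simp add: xs late_leaves_append sum_list_addf del: filter.simps)
  qed
  with opt show ?thesis by blast
qed

lemma optimal_list_leaves_consecutive:
  assumes leaf: "\<And>w x. w \<in> leaf_nbrs G x \<Longrightarrow> leaf_nbrs G w = {}"
  shows "\<exists>xs. optimal_list G xs \<and> sorted_wrt (\<lambda>u v. v \<notin> leaf_nbrs G u) xs \<and>
     (\<forall>x\<in>pverts G. \<exists>S R U. xs = S @ R @ U \<and> set R = leaf_nbrs G x)"
proof -
  let ?L = "\<lambda>xs. optimal_list G xs \<and> sorted_wrt (\<lambda>u v. v \<notin> leaf_nbrs G u) xs"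
  let ?adj = "adjacencies (siblings G)"
  \<comment> \<open>A uniform bound, needed for a maximum to exist.\<close>
  have "?adj xs < Suc (card (pverts G))" if "?L xs" for xs
    using that adjacencies_le[of "siblings G" xs] distinct_card[of xs]
    by (auto simp: optimal_list_def vertex_list_def)
  moreover obtain xs0 where "?L xs0"
    using optimal_list_leaves_first leaf by blast
  ultimately obtain xs where opt: "optimal_list G xs"
    and sorted: "sorted_wrt (\<lambda>u v. v \<notin> leaf_nbrs G u) xs"
    and max: "\<And>ys. ?L ys \<Longrightarrow> ?adj ys \<le> ?adj xs"
    using ex_has_greatest_nat[of ?L xs0 ?adj "Suc (card (pverts G))"] by blast
  have V: "set xs = pverts G"
    using opt by (simp add: optimal_list_def vertex_list_def)
  have "\<exists>S R U. xs = S @ R @ U \<and> set R = leaf_nbrs G x" if xV: "x \<in> pverts G" for x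
  proof (rule ccontr)
    assume neg: "\<not> ?thesis"
    let ?P = "\<lambda>v. v \<in> leaf_nbrs G x"
    define S where "S = takeWhile (Not \<circ> ?P) xs"
    define V1 where "V1 = dropWhile (Not \<circ> ?P) xs"
    define R where "R = takeWhile ?P V1"
    define V2 where "V2 = dropWhile ?P V1"
    define T where "T = takeWhile (Not \<circ> ?P) V2"
    define V3 where "V3 = dropWhile (Not \<circ> ?P) V2"
    define R' where "R' = takeWhile ?P V3"
    define U where "U = dropWhile ?P V3"
    have V3: "V3 = R' @ U" and V2: "V2 = T @ V3" and V1: "V1 = R @ V2" and xs1: "xs = S @ V1"
      unfolding U_def R'_def V3_def T_def V2_def R_def V1_def S_def by simp_all
    have SRT: "set S \<inter> leaf_nbrs G x = {}" "set R \<subseteq> leaf_nbrs G x"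
        "set T \<inter> leaf_nbrs G x = {}" "set R' \<subseteq> leaf_nbrs G x"
      unfolding R'_def T_def R_def S_def by (auto dest: set_takeWhileD)
    have "V3 \<noteq> []"
    \<comment> \<open>Without a second run, \<open>R\<close> contains all leaves at \<open>x\<close>
      (possibly none), against \<open>neg\<close>.\<close>
    proof
      assume "V3 = []"
      then have "set R = leaf_nbrs G x"
        using SRT V leaf_nbrs_subset[of x] by (auto simp: xs1 V1 V2)
      with neg show False
        using xs1 V1 by blast
    qed
    have "?P (hd V3)"
      using hd_dropWhile[of "Not \<circ> ?P" V2] \<open>V3 \<noteq> []\<close> unfolding V3_def by auto
    then have "R' \<noteq> []"
      using \<open>V3 \<noteq> []\<close> unfolding R'_def by (cases V3) auto
    have "V2 \<noteq> []"
      using \<open>V3 \<noteq> []\<close> unfolding V2 by simp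
    then have "\<not> ?P (hd V2)"
      using hd_dropWhile[of ?P V1] unfolding V2_def by auto
    then have "T \<noteq> []"
      using \<open>V2 \<noteq> []\<close> unfolding T_def by (cases V2) auto
    have "V1 \<noteq> []"
      using \<open>V2 \<noteq> []\<close> unfolding V1 by simp
    then have "?P (hd V1)"
      using hd_dropWhile[of "Not \<circ> ?P" xs] unfolding V1_def by auto
    then have "R \<noteq> []"
      using \<open>V1 \<noteq> []\<close> unfolding R_def by (cases V1) auto
    have U: "\<not> ?P (hd U)" if "U \<noteq> []"
      using hd_dropWhile[of ?P V3] that unfolding U_def by auto
    have xs: "xs = S @ R @ T @ R' @ U"
      by (simp add: xs1 V1 V2 V3)
    have R'x: "hd R' \<in> set R'" "hd R' \<in> leaf_nbrs G x"
      using \<open>R' \<noteq> []\<close> SRT by auto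
    \<comment> \<open>A leaf at \<open>x\<close> in the second run forces \<open>x\<close> to come
      later than \<open>S\<close>, \<open>R\<close> and \<open>T\<close>.\<close>
    have "\<forall>a\<in>set (S @ R @ T). hd R' \<notin> leaf_nbrs G a"
      using sorted R'x(1) unfolding xs by (auto simp: sorted_wrt_append)
    then have "x \<notin> set (S @ R @ T)"
      using R'x(2) by blast
    moreover have "x \<notin> set R'"
      using SRT leaf_nbrs_arc by blast
    ultimately have opt': "optimal_list G (S @ R @ R' @ T @ U)"
      using boundary_cost_join_leaf_runs[of S R T R' U x] opt SRT \<open>R \<noteq> []\<close> xs by auto
    have "sorted_wrt (\<lambda>u v. v \<notin> leaf_nbrs G u) (S @ R @ R' @ T @ U)"
    proof -
      \<comment> \<open>The only pairs whose order is reversed now have a vertex of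
        \<open>R'\<close> first, and no leaf hangs at such a vertex.\<close>
      have "\<forall>a\<in>set R'. leaf_nbrs G a = {}"
        using SRT leaf by blast
      then show ?thesis
        using sorted unfolding xs by (auto simp: sorted_wrt_append)
    qed
    with opt' max have "?adj (S @ R @ R' @ T @ U) \<le> ?adj xs"
      by blast
    moreover have sib: "siblings G u v \<longleftrightarrow> ?P v" "siblings G v u \<longleftrightarrow> ?P v" if "?P u" for u v
      using that leaf_nbrs_unique by (auto simp: siblings_def)
    have "?P (last R)" "?P (hd R')" "?P (last R')" "\<not> ?P (hd T)" "\<not> ?P (last T)"
      using SRT \<open>R \<noteq> []\<close> \<open>T \<noteq> []\<close> \<open>R' \<noteq> []\<close> by (auto dest: hd_in_set last_in_set)
    \<comment> \<open>Only junctions matter: those of \<open>R\<close> with \<open>T\<close>,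
      \<open>T\<close> with \<open>R'\<close> and \<open>R'\<close> with \<open>U\<close> counted
      nothing, while \<open>R\<close> with \<open>R'\<close> now counts one.\<close>
    then have "?adj (S @ R @ R' @ T @ U) > ?adj xs"
      using \<open>R \<noteq> []\<close> \<open>T \<noteq> []\<close> \<open>R' \<noteq> []\<close> U
      by (auto simp: adjacencies_append xs sib)
    ultimately show False by simp
  qed
  with opt sorted show ?thesis by blast
qed

section \<open>Conformality of the ordering read off from the list\<close>

lemma conformal_forI:
  assumes xs: "vertex_list G xs" "sorted_wrt (\<lambda>u v. v \<notin> leaf_nbrs G u) xs"
    and x: "x \<in> pverts G" and eq: "xs = S @ R @ U" and R: "set R = leaf_nbrs G x"
    and \<alpha>: "\<And>i. i < length xs \<Longrightarrow> \<alpha> (xs ! i) = Suc i"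
  shows "conformal_for G \<alpha> x"
  unfolding conformal_for_def
proof (intro conjI ballI exI)
  \<comment> \<open>Positions start at 1, so the run begins at \<open>Suc (length S)\<close>; an
    empty \<open>R\<close> yields an empty interval.\<close>
  have "map \<alpha> R = [Suc (length S)..<Suc (length S + length R)]"
  proof (rule nth_equalityI)
    fix i assume "i < length (map \<alpha> R)"
    then show "map \<alpha> R ! i = [Suc (length S)..<Suc (length S + length R)] ! i"
      using \<alpha>[of "length S + i"] by (simp add: eq nth_append del: upt_Suc)
  qed (simp del: upt_Suc)
  then have "set (map \<alpha> R) = {Suc (length S)..length S + length R}"
    by (simp only: set_upt atLeastLessThanSuc_atLeastAtMost)
  then show "\<alpha> ` leaf_nbrs G x = {Suc (length S)..length S + length R}"
    using R by simp
next
  fix w assume w: "w \<in> leaf_nbrs G x"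
  obtain i j where ij: "i < length xs" "j < length xs" "xs ! i = w" "xs ! j = x"
    using xs(1) w x leaf_nbrs_subset by (metis in_set_conv_nth subsetD vertex_list_def)
  have "\<not> j < i" "i \<noteq> j"
    using xs(2) w ij leaf_nbrs_arc[OF w] by (auto simp: sorted_wrt_iff_nth_less)
  then show "\<alpha> w < \<alpha> x"
    using \<alpha> ij by force
qed

end

theorem theorem3p4:
  fixes G :: "'a pair_pre_digraph"
  assumes "pair_graph G"
    and "Digraph_Component.connected (with_proj G)"
    and "card (pverts G) \<noteq> 2"
  shows "\<exists>\<alpha>. optimal_ordering G \<alpha> \<and> conformal G \<alpha>"
proof -
  interpret pair_graph G by fact
  have "leaf_nbrs G w = {}" if "w \<in> leaf_nbrs G x" for w x
    using leaf_nbrs_of_leaf[OF assms(2,3) that] .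
  then obtain xs where opt: "optimal_list G xs"
    and sorted: "sorted_wrt (\<lambda>u v. v \<notin> leaf_nbrs G u) xs"
    and runs: "\<forall>x\<in>pverts G. \<exists>S R U. xs = S @ R @ U \<and> set R = leaf_nbrs G x"
    using optimal_list_leaves_consecutive by metis
  have xs: "vertex_list G xs"
    using opt by (simp add: optimal_list_def)
  then obtain \<alpha> where \<alpha>: "graph_ordering G \<alpha>" "\<And>i. i < length xs \<Longrightarrow> \<alpha> (xs ! i) = Suc i"
    using vertex_list_imp_graph_ordering by metis
  have "conformal G \<alpha>"
    unfolding conformal_def
  proof
    fix x assume x: "x \<in> pverts G"
    with runs obtain S R U where "xs = S @ R @ U" "set R = leaf_nbrs G x"
      by blast
    then show "conformal_for G \<alpha> x"
      using conformal_forI[OF xs sorted x _ _ \<alpha>(2)] by blast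
  qed
  with optimal_list_imp_optimal_ordering[OF opt \<alpha>] show ?thesis
    by blast
qed

end
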